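(* Let $n\ge0$. For any $w\in K(S_{n+1})$, $$\mathrm{Des}_A(w)=\{i+1\mid i\in\mathrm{Des}_B(\varphi_n(w))\},\qquad \mathrm{DDes}_A(w)=\{i+1\mid i\in\mathrm{DDes}_B(\varphi_n(w))\}.$$
   Context: Notation: $[m,n]=\{m,\dots,n\}$, $[n]=[1,n]$, $\bar a=-a$. $S_n$ is the symmetric group on $[n]$. $B_n$ is the group of signed permutations: bijections $w$ of $\{\pm1,\dots,\pm n\}$ with $w(-i)=-w(i)$, written $w=w_1\cdots w_n$, $w_i=w(i)$; $S_n\subseteq B_n$ consists of those with all $w_i>0$. $B_0=\{\varepsilon\}$ with $\varepsilon$ the empty signed permutation. For a word $a$ of distinct integers, $\mathrm{st}(a)\in S_m$ is the permutation with the same relative order as $a$. For a word $a=a_1\cdots a_m$ of nonzero integers with distinct absolute values, $\mathrm{sts}(a)\in B_m$ is the signed permutation whose $i$-th entry has the sign of $a_i$ and whose absolute values have the same relative order as $|a_1|,\dots,|a_m|$. $w$ contains the pattern $u\in B_m$ if $\mathrm{sts}(w_{i_1}\cdots w_{i_m})=u$ for some $i_1<\cdots<i_m$; otherwise it avoids $u$. $K(B_n)$ is the set of separable $w\in B_n$, i.e. those avoiding $\bar21$, $2\bar1$, $3142$, $2413$, $\bar3\,\bar1\,\bar4\,\bar2$, $\bar2\,\bar4\,\bar1\,\bar3$. $K(S_n)=K(B_n)\cap S_n$ is the set of permutations avoiding $3142$ and $2413$. For $u\in B_p$, $v\in B_q$: $u\oplus v\in B_{p+q}$ has $(u\oplus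 v)_i=u_i$ for $i\le p$ and $v_{i-p}+(\mathrm{sgn}\,v_{i-p})p$ for $i>p$; $\varepsilon$ is the identity for $\oplus$. $w_0^{S_m}=m(m-1)\cdots1$ and $w_0^{B_m}=\bar1\,\bar2\cdots\bar m$, products being compositions: for $v\in S_m$, $w_0^{B_m}w_0^{S_m}v$ has entries $-(m+1-v_i)$. For $w\in S_n$, $p\in[n-1]$ is a global ascent ($p\in\mathrm{GAsc}(w)$), resp. global descent ($p\in\mathrm{GDes}(w)$), if $w_i<w_j$, resp. $w_i>w_j$, for all $i\in[p]$, $j\in[p+1,n]$. Every separable permutation of length at least $2$ has a global ascent or a global descent. The map $\varphi_n:K(S_{n+1})\to K(B_n)$ is defined recursively by $\varphi_0(1)=\varepsilon$ and, for $n\ge1$ and $w\in K(S_{n+1})$, $$\varphi_n(w)=\begin{cases}\varphi_{p-1}(w_1\cdots w_p)\oplus\mathrm{st}(w_{p+1}\cdots w_{n+1}),&p\in\mathrm{GAsc}(w),\\ \varphi_{p-1}(\mathrm{st}(w_1\cdots w_p))\oplus w_0^{B_{n+1-p}}w_0^{S_{n+1-p}}(w_{p+1}\cdots w_{n+1}),&p\in\mathrm{GDes}(w),\end{cases}$$ the value being independent of the choice of $p$. Descents. For $w\in B_n$, with conventions $w_0=0$, $w_{-1}=w_{n+1}=+\infty$: $\mathrm{Des}_B(w)=\{i\in[0,n]: w_i>w_{i+1}\}$ and $\mathrm{DDes}_B(w)=\{i\in[0,n]: w_{i-1}>w_i>w_{i+1}\}$. For $w\in S_n$, with conventions $w_0=w_{n+1}=+\infty$: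 $\mathrm{Des}_A(w)=\{i\in[n]:w_i>w_{i+1}\}$ and $\mathrm{DDes}_A(w)=\{i\in[n]:w_{i-1}>w_i>w_{i+1}\}$. *)

theory Defs
  imports Main "HOL-Library.Sublist" "HOL-Library.Extended"
begin

text \<open>
  A signed permutation \<open>w\<close> of \<open>\<plusminus>1, \<dots>, \<plusminus>n\<close> (a bijection with \<open>w(-i) = -w(i)\<close>) is represented
  by its word \<open>w(1) \<dots> w(n)\<close>. Letters are numbered from 1 in the definitions below, whereas list
  access \<open>!\<close> starts at 0.
\<close>

text \<open>The \<open>n\<close> letters have to cover \<open>n\<close> absolute values, so these are pairwise distinct.\<close>

definition B :: "nat \<Rightarrow> int list set" where
  "B n = {w. length w = n \<and> abs ` set w = {1..int n}}"

definition S :: "nat \<Rightarrow> int list set" where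
  "S n = {w \<in> B n. \<forall>x \<in> set w. 0 < x}"

text \<open>Value of the signed permutation \<open>w\<close> at \<open>i \<in> {\<plusminus>1, \<dots>, \<plusminus>n}\<close>.\<close>

definition app :: "int list \<Rightarrow> int \<Rightarrow> int" where
  "app w i = sgn i * w ! (nat \<bar>i\<bar> - 1)"

definition comp_sp :: "int list \<Rightarrow> int list \<Rightarrow> int list"  (infixl \<open>\<cdot>\<close> 70) where
  "u \<cdot> v = map (app u) v"

text \<open>
  Standardization of words with distinct letters, resp.\ of words of nonzero letters with distinct
  absolute values: each letter is replaced by its rank.
\<close>

definition st :: "int list \<Rightarrow> int list" where
  "st a = map (\<lambda>x. int (card {y \<in> set a. y \<le> x})) a"

definition sts :: "int list \<Rightarrow> int list" where
  "sts a = map (\<lambda>x. sgn x * int (card {y \<in> set a. \<bar>y\<bar> \<le> \<bar>x\<bar>})) a"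

definition contains :: "int list \<Rightarrow> int list \<Rightarrow> bool" where
  "contains w u \<longleftrightarrow> (\<exists>v. subseq v w \<and> sts v = u)"

definition K_B :: "nat \<Rightarrow> int list set" where
  "K_B n = {w \<in> B n. \<forall>u \<in> {[-2, 1], [2, -1], [3, 1, 4, 2], [2, 4, 1, 3],
                               [-3, -1, -4, -2], [-2, -4, -1, -3]}. \<not> contains w u}"

definition K_S :: "nat \<Rightarrow> int list set" where
  "K_S n = K_B n \<inter> S n"

definition osum :: "int list \<Rightarrow> int list \<Rightarrow> int list"  (infixl \<open>\<oplus>\<close> 65) where
  "u \<oplus> v = u @ map (\<lambda>x. x + sgn x * int (length u)) v"

definition w0_S :: "nat \<Rightarrow> int list" where
  "w0_S m = rev [1..int m]"

definition w0_B :: "nat \<Rightarrow> int list" where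
  "w0_B m = map uminus [1..int m]"

definition GAsc :: "int list \<Rightarrow> nat set" where
  "GAsc w = {p \<in> {1..length w - 1}.
     \<forall>i \<in> {1..p}. \<forall>j \<in> {p+1..length w}. w ! (i - 1) < w ! (j - 1)}"

definition GDes :: "int list \<Rightarrow> nat set" where
  "GDes w = {p \<in> {1..length w - 1}.
     \<forall>i \<in> {1..p}. \<forall>j \<in> {p+1..length w}. w ! (i - 1) > w ! (j - 1)}"

text \<open>
  The recursion for the map \<open>\<phi>\<^sub>n : K(S\<^sub>n\<^sub>+\<^sub>1) \<rightarrow> K(B\<^sub>n)\<close> leaves the choice of the global ascent or
  descent \<open>p\<close> open. The relation \<open>phi_graph n w u\<close> says that \<open>u\<close> is obtained from \<open>w\<close> by the
  recursion for some choices of \<open>p\<close>; \<open>phi n w\<close> is the value that does not depend on these choices.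
\<close>

inductive phi_graph :: "nat \<Rightarrow> int list \<Rightarrow> int list \<Rightarrow> bool" where
  base: "phi_graph 0 [1] []"
| asc: "phi_graph n w (u \<oplus> st (drop p w))"
    if "n \<ge> 1" "w \<in> K_S (n + 1)" "p \<in> GAsc w" "phi_graph (p - 1) (take p w) u"
| des: "phi_graph n w (u \<oplus> (w0_B (n + 1 - p) \<cdot> w0_S (n + 1 - p) \<cdot> drop p w))"
    if "n \<ge> 1" "w \<in> K_S (n + 1)" "p \<in> GDes w" "phi_graph (p - 1) (st (take p w)) u"

definition phi :: "nat \<Rightarrow> int list \<Rightarrow> int list" where
  "phi n w = (THE u. phi_graph n w u)"

text \<open>
  Letters of \<open>w\<close> at arbitrary integer positions, where \<open>w\<^sub>0 = 0\<close> in type B, \<open>w\<^sub>0 = \<infinity>\<close> in type A,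
  and \<open>w\<^sub>i = \<infinity>\<close> at all other positions outside \<open>{1..n}\<close> (only \<open>-1\<close> and \<open>n + 1\<close> occur).
\<close>

definition letter_B :: "int list \<Rightarrow> int \<Rightarrow> int extended" where
  "letter_B w i = (if i = 0 then Fin 0
                   else if 1 \<le> i \<and> i \<le> int (length w) then Fin (w ! (nat i - 1))
                   else Pinf)"

definition letter_A :: "int list \<Rightarrow> int \<Rightarrow> int extended" where
  "letter_A w i = (if 1 \<le> i \<and> i \<le> int (length w) then Fin (w ! (nat i - 1)) else Pinf)"

definition Des_B :: "int list \<Rightarrow> int set" where
  "Des_B w = {i \<in> {0..int (length w)}. letter_B w i > letter_B w (i + 1)}"

definition DDes_B :: "int list \<Rightarrow> int set" where
  "DDes_B w = {i \<in> {0..int (length w)}.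
     letter_B w (i - 1) > letter_B w i \<and> letter_B w i > letter_B w (i + 1)}"

definition Des_A :: "int list \<Rightarrow> int set" where
  "Des_A w = {i \<in> {1..int (length w)}. letter_A w i > letter_A w (i + 1)}"

definition DDes_A :: "int list \<Rightarrow> int set" where
  "DDes_A w = {i \<in> {1..int (length w)}.
     letter_A w (i - 1) > letter_A w i \<and> letter_A w i > letter_A w (i + 1)}"

end

theory Submission
  imports Defs
begin

section \<open>Order-isomorphic words\<close>

text \<open>The key fact is that the word \<open>0 # phi n w\<close> has the same relative order as
  \<open>w\<close>. The type B conventions for a word \<open>u\<close> are the type A conventions
  for \<open>0 # u\<close> moved by one position, and type A descents and double descents depend
  only on relative order, so both equalities follow at once.

  The key fact is proved along the recursion (\<open>phi_graph_inv\<close>, with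
  \<open>phi_inv_append\<close> as the common step). At a global ascent the new block is appended
  with positive letters that exceed 0 and everything before. At a global descent it is appended with
  negative letters that lie below 0 and everything before. Inside the block the order is kept.

  Since \<open>phi\<close> is a definite description, the recursion must also be shown to yield
  exactly one value. For uniqueness the invariant \<open>phi_inv\<close> records enough to recover
  \<open>u\<close> from \<open>w\<close>, whatever cuts were chosen (\<open>phi_inv_unique\<close>).
  For existence, every separable permutation of length at least 2 has a global ascent or descent
  (\<open>global_ascent_exists\<close>), and the standardized prefix is again separable
  (\<open>K_S_st_take\<close>).\<close>

definition order_iso :: "int list \<Rightarrow> int list \<Rightarrow> bool" where
  "order_iso a b \<longleftrightarrow> length a = length b \<and>
     (\<forall>i<length a. \<forall>j<length a. a ! i < a ! j \<longleftrightarrow> b ! i < b ! j)"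

lemma order_iso_trans: "order_iso a b \<Longrightarrow> order_iso b c \<Longrightarrow> order_iso a c"
  by (simp add: order_iso_def)

lemma order_iso_map:
  assumes "strict_mono_on (set a) f"
  shows "order_iso (map f a) a"
  unfolding order_iso_def
  by (auto simp: strict_mono_on_less[OF assms])

text \<open>Comparisons across the two blocks come out alike because the first block lies wholly
  below, or wholly above, the second in both words.\<close>

lemma order_iso_append:
  assumes "order_iso a a'" "order_iso b b'"
    and "(\<forall>x\<in>set a. \<forall>y\<in>set b. x < y) \<and> (\<forall>x\<in>set a'. \<forall>y\<in>set b'. x < y) \<or>
         (\<forall>x\<in>set a. \<forall>y\<in>set b. x > y) \<and> (\<forall>x\<in>set a'. \<forall>y\<in>set b'. x > y)"
  shows "order_iso (a @ b) (a' @ b')"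
proof -
  have l: "length a' = length a" "length b' = length b"
    using assms(1,2) by (auto simp: order_iso_def)
  have "(a @ b) ! i < (a @ b) ! j \<longleftrightarrow> (a' @ b') ! i < (a' @ b') ! j"
    if "i < length (a @ b)" "j < length (a @ b)" for i j
  proof -
    consider "i < length a" "j < length a" | "i < length a" "\<not> j < length a"
      | "\<not> i < length a" "j < length a" | "\<not> i < length a" "\<not> j < length a" by blast
    then show ?thesis
    proof cases
      case 1
      then show ?thesis using assms(1) l by (auto simp: nth_append order_iso_def)
    next
      case 2
      then have "a ! i \<in> set a" "a' ! i \<in> set a'" "b ! (j - length a) \<in> set b"
        "b' ! (j - length a) \<in> set b'" using that l by auto
      then have "a ! i < b ! (j - length a) \<and> a' ! i < b' ! (j - length a) \<or>
        a ! i > b ! (j - length a) \<and> a' ! i > b' ! (j - length a)" using assms(3) by blast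
      then show ?thesis using 2 l by (auto simp: nth_append)
    next
      case 3
      then have "a ! j \<in> set a" "a' ! j \<in> set a'" "b ! (i - length a) \<in> set b"
        "b' ! (i - length a) \<in> set b'" using that l by auto
      then have "a ! j < b ! (i - length a) \<and> a' ! j < b' ! (i - length a) \<or>
        a ! j > b ! (i - length a) \<and> a' ! j > b' ! (i - length a)" using assms(3) by blast
      then show ?thesis using 3 l by (auto simp: nth_append)
    next
      case 4
      then show ?thesis using assms(2) l that by (auto simp: nth_append order_iso_def)
    qed
  qed
  then show ?thesis using l by (simp add: order_iso_def)
qed

lemma strict_mono_on_rank:
  assumes "finite A"
  shows "strict_mono_on A (\<lambda>x::int. int (card {y \<in> A. y \<le> x}))"
proof (rule strict_mono_onI)
  fix r s assume "r \<in> A" "s \<in> A" "r < s"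
  then have "{y \<in> A. y \<le> r} \<subset> {y \<in> A. y \<le> s}" by force
  then show "int (card {y \<in> A. y \<le> r}) < int (card {y \<in> A. y \<le> s})"
    using assms by (simp add: psubset_card_mono)
qed

lemma order_iso_st: "order_iso (st a) a"
  unfolding st_def by (intro order_iso_map strict_mono_on_rank) simp

lemma st_eq_self:
  assumes "\<And>x. x \<in> set a \<Longrightarrow> {1..x} \<subseteq> set a" "\<And>x. x \<in> set a \<Longrightarrow> 0 < x"
  shows "st a = a"
proof -
  have "int (card {y \<in> set a. y \<le> x}) = x" if "x \<in> set a" for x
  proof -
    have "{y \<in> set a. y \<le> x} = {1..x}" using assms[OF that] assms(2) by force
    then show ?thesis using assms(2)[OF that] by simp
  qed
  then show ?thesis by (simp add: st_def map_idI)
qed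

text \<open>The ranks lie between 1 and the length and are pairwise distinct, so by counting they
  fill the interval.\<close>

lemma set_st:
  assumes "distinct a"
  shows "set (st a) = {1..int (length a)}"
proof (rule card_subset_eq)
  have "0 < card {y \<in> set a. y \<le> x} \<and> card {y \<in> set a. y \<le> x} \<le> length a" if "x \<in> set a" for x
    using that card_mono[of "set a" "{y \<in> set a. y \<le> x}"] distinct_card[OF assms]
    by (auto simp: card_gt_0_iff)
  then show "set (st a) \<subseteq> {1..int (length a)}" by (force simp: st_def)
  have "inj_on (\<lambda>x. int (card {y \<in> set a. y \<le> x})) (set a)"
    by (intro strict_mono_on_imp_inj_on strict_mono_on_rank) simp
  then show "card (set (st a)) = card {1..int (length a)}"
    by (simp add: st_def card_image distinct_card[OF assms])
qed simp

lemma length_st [simp]: "length (st a) = length a"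
  by (simp add: st_def)

lemma S_iff: "w \<in> S n \<longleftrightarrow> length w = n \<and> set w = {1..int n}"
proof
  assume w: "w \<in> S n"
  then have "abs ` set w = set w" by (intro trans[OF image_cong[OF refl] image_ident]) (auto simp: S_def)
  then show "length w = n \<and> set w = {1..int n}" using w by (simp add: S_def B_def)
next
  assume w: "length w = n \<and> set w = {1..int n}"
  then have "abs ` set w = set w" by (intro trans[OF image_cong[OF refl] image_ident]) simp
  then show "w \<in> S n" using w by (simp add: S_def B_def)
qed

lemma st_in_S: "distinct a \<Longrightarrow> st a \<in> S (length a)"
  by (simp add: S_iff set_st)

lemma B_distinct_abs: "w \<in> B n \<Longrightarrow> distinct (map abs w)"
  by (rule card_distinct) (simp add: B_def)

lemma S_distinct: "w \<in> S n \<Longrightarrow> distinct w"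
  by (auto simp: S_def dest!: B_distinct_abs simp: distinct_map)

section \<open>Global ascents and descents\<close>

text \<open>Passes from positions numbered from 1 to the two blocks of the word; \<open>R\<close> is
  left open to serve both ascents and descents.\<close>

lemma ball_nth_take_drop:
  assumes "p < length w"
  shows "(\<forall>i\<in>{1..p}. \<forall>j\<in>{p+1..length w}. R (w ! (i - 1)) (w ! (j - 1))) \<longleftrightarrow>
         (\<forall>x\<in>set (take p w). \<forall>y\<in>set (drop p w). R x y)"
proof -
  have "set (take p w) = (\<lambda>i. w ! (i - 1)) ` {1..p}"
  proof -
    have "set (take p w) = (!) w ` {0..<p}" using assms by (simp add: nth_image)
    also have "{0..<p} = (\<lambda>i. i - 1) ` {1..p}" by (force simp: image_iff)
    finally show ?thesis by (simp add: image_image)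
  qed
  moreover have "set (drop p w) = (\<lambda>j. w ! (j - 1)) ` {p+1..length w}"
  proof -
    have "drop p w = map ((!) w) [p..<length w]"
      using assms by (intro nth_equalityI) auto
    then have "set (drop p w) = (!) w ` {p..<length w}" by simp
    also have "{p..<length w} = (\<lambda>i. i - 1) ` {p+1..length w}" by (force simp: image_iff)
    finally show ?thesis by (simp add: image_image)
  qed
  ultimately show ?thesis by simp
qed

lemma GAsc_iff:
  "p \<in> GAsc w \<longleftrightarrow> 0 < p \<and> p < length w \<and>
     (\<forall>x\<in>set (take p w). \<forall>y\<in>set (drop p w). x < y)"
  using ball_nth_take_drop[of p w "(<)"] by (auto simp: GAsc_def simp del: One_nat_def)

lemma GDes_iff:
  "p \<in> GDes w \<longleftrightarrow> 0 < p \<and> p < length w \<and>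
     (\<forall>x\<in>set (take p w). \<forall>y\<in>set (drop p w). x > y)"
  using ball_nth_take_drop[of p w "(>)"] by (auto simp: GDes_def simp del: One_nat_def)

text \<open>The letters before a global ascent are the smallest ones, so they form an initial
  interval. This reconciles the ascent rule, which recurses on the bare prefix, with the general
  fact about standardized prefixes.\<close>

lemma st_take_GAsc:
  assumes "w \<in> S n" "p \<in> GAsc w"
  shows "st (take p w) = take p w"
proof (rule st_eq_self)
  have u: "set (take p w) \<union> set (drop p w) = {1..int n}"
    using assms(1) by (metis S_iff append_take_drop_id set_append)
  show "0 < x" if "x \<in> set (take p w)" for x
  proof -
    have "x \<in> {1..int n}" using u that by blast
    then show ?thesis by simp
  qed
  show "{1..x} \<subseteq> set (take p w)" if "x \<in> set (take p w)" for x
  proof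
    fix y assume y: "y \<in> {1..x}"
    moreover have "x \<in> {1..int n}" using u that by blast
    ultimately have "y \<in> set (take p w) \<union> set (drop p w)" unfolding u by simp
    moreover have "y \<notin> set (drop p w)" using assms(2) that y unfolding GAsc_iff by force
    ultimately show "y \<in> set (take p w)" by blast
  qed
qed

text \<open>The letters after a global descent are the smallest ones, so the suffix is itself a
  permutation and \<open>w0_mult\<close> applies to it.\<close>

lemma st_drop_GDes:
  assumes "w \<in> S n" "p \<in> GDes w"
  shows "st (drop p w) = drop p w"
proof (rule st_eq_self)
  have u: "set (take p w) \<union> set (drop p w) = {1..int n}"
    using assms(1) by (metis S_iff append_take_drop_id set_append)
  show "0 < x" if "x \<in> set (drop p w)" for x
  proof -
    have "x \<in> {1..int n}" using u that by blast
    then show ?thesis by simp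
  qed
  show "{1..x} \<subseteq> set (drop p w)" if "x \<in> set (drop p w)" for x
  proof
    fix y assume y: "y \<in> {1..x}"
    moreover have "x \<in> {1..int n}" using u that by blast
    ultimately have "y \<in> set (take p w) \<union> set (drop p w)" unfolding u by simp
    moreover have "y \<notin> set (take p w)" using assms(2) that y unfolding GDes_iff by force
    ultimately show "y \<in> set (drop p w)" by blast
  qed
qed

section \<open>The order type of the values of the recursion\<close>

text \<open>
  Since \<open>0 # u\<close> has the order type of \<open>w\<close>, the sign of a letter of \<open>u\<close> tells whether the
  corresponding letter of \<open>w\<close> is above or below the first one. The last conjunct fixes the
  interleaving of the absolute values of positive and negative letters, so that \<open>w\<close> determines \<open>u\<close>.
\<close>

definition phi_inv :: "int list \<Rightarrow> int list \<Rightarrow> bool" where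
  "phi_inv w u \<longleftrightarrow> order_iso (0 # u) w \<and> u \<in> B (length u) \<and>
     (\<forall>i j. i < j \<longrightarrow> j < length u \<longrightarrow> sgn (u ! i) \<noteq> sgn (u ! j) \<longrightarrow> \<bar>u ! i\<bar> < \<bar>u ! j\<bar>)"

text \<open>Induction step shared by both rules, with \<open>s\<close> the common sign of the new
  letters. The word \<open>a\<close> fed to the recursion may differ from the prefix
  \<open>a'\<close>, since the descent rule standardizes the prefix.\<close>

lemma phi_inv_append:
  assumes inv: "phi_inv a u" and a': "order_iso a a'"
    and v: "v \<in> B (length v)" "order_iso v b" and s: "\<And>x. x \<in> set v \<Longrightarrow> sgn x = s"
    and cross: "s = 1 \<and> (\<forall>x\<in>set a'. \<forall>y\<in>set b. x < y) \<or> s = -1 \<and> (\<forall>x\<in>set a'. \<forall>y\<in>set b. x > y)"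
  shows "phi_inv (a' @ b) (u \<oplus> v)"
proof -
  let ?n = "int (length u)"
  define v' where "v' = map (\<lambda>x. x + sgn x * ?n) v"
  have v'_s: "v' = map (\<lambda>x. x + s * ?n) v" using s by (simp add: v'_def)
  have uv: "u \<oplus> v = u @ v'" by (simp add: osum_def v'_def)
  have absu: "abs ` set u = {1..?n}" and absv: "abs ` set v = {1..int (length v)}"
    using inv v(1) by (auto simp: phi_inv_def B_def)
  have abs_v': "\<bar>x + s * ?n\<bar> = \<bar>x\<bar> + ?n" "sgn (x + s * ?n) = s" if "x \<in> set v" for x
    using s[OF that] cross by (auto simp: sgn_if split: if_splits)
  have absu_le: "\<bar>x\<bar> \<le> ?n" if "x \<in> set u" for x
    using absu imageI[OF that, of abs] by simp
  have absv_ge: "1 \<le> \<bar>x\<bar>" if "x \<in> set v" for x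
    using absv imageI[OF that, of abs] by simp
  have gt: "\<bar>y\<bar> > ?n" "sgn y = s" if y: "y \<in> set v'" for y
  proof -
    obtain x where "x \<in> set v" "y = x + s * ?n" using y by (auto simp: v'_s)
    then show "\<bar>y\<bar> > ?n" "sgn y = s" using abs_v'[of x] absv_ge[of x] by auto
  qed
  have "order_iso v' v" unfolding v'_s by (intro order_iso_map) (simp add: strict_mono_on_def)
  then have iso_v: "order_iso v' b" using v(2) by (rule order_iso_trans)
  have iso_u: "order_iso (0 # u) a'"
    using inv a' order_iso_trans by (auto simp: phi_inv_def)
  have "order_iso ((0 # u) @ v') (a' @ b)"
  proof (rule order_iso_append[OF iso_u iso_v])
    \<comment> \<open>The new letters have absolute value above \<open>length u\<close>, so their
      sign alone places them above or below both 0 and \<open>u\<close>.\<close>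
    have "x < y" if "s = 1" "x \<in> set (0 # u)" "y \<in> set v'" for x y
      using gt[OF that(3)] absu_le[of x] that by (auto simp: sgn_if split: if_splits)
    moreover have "x > y" if "s = -1" "x \<in> set (0 # u)" "y \<in> set v'" for x y
      using gt[OF that(3)] absu_le[of x] that by (auto simp: sgn_if split: if_splits)
    ultimately show "(\<forall>x\<in>set (0 # u). \<forall>y\<in>set v'. x < y) \<and> (\<forall>x\<in>set a'. \<forall>y\<in>set b. x < y) \<or>
         (\<forall>x\<in>set (0 # u). \<forall>y\<in>set v'. x > y) \<and> (\<forall>x\<in>set a'. \<forall>y\<in>set b. x > y)"
      using cross by blast
  qed
  moreover have "u @ v' \<in> B (length (u @ v'))"
  proof -
    have "abs ` set v' = (\<lambda>x. x + ?n) ` abs ` set v"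
      using abs_v'(1) by (simp add: v'_s image_image)
    also have "\<dots> = {1 + ?n..int (length v) + ?n}" by (simp add: absv add.commute)
    finally have "abs ` set (u @ v') = {1..?n} \<union> {1 + ?n..int (length v) + ?n}"
      by (simp add: image_Un absu)
    also have "\<dots> = {1..int (length (u @ v'))}" by (auto simp: v'_def)
    finally show ?thesis by (simp add: B_def)
  qed
  moreover have "\<bar>(u @ v') ! i\<bar> < \<bar>(u @ v') ! j\<bar>"
    if "i < j" "j < length (u @ v')" "sgn ((u @ v') ! i) \<noteq> sgn ((u @ v') ! j)" for i j
  proof (cases "j < length u")
    case True
    then show ?thesis using inv that by (auto simp: phi_inv_def nth_append)
  next
    case False
    then have j: "(u @ v') ! j \<in> set v'" using that(2) by (auto simp: nth_append)
    \<comment> \<open>All letters of \<open>v'\<close> have sign \<open>s\<close>, so a pair of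
      different signs ending in \<open>v'\<close> must start in \<open>u\<close>.\<close>
    have "i < length u"
    proof (rule ccontr)
      assume "\<not> i < length u"
      then have "(u @ v') ! i \<in> set v'" using that by (auto simp: nth_append)
      then show False using gt(2) j that(3) by simp
    qed
    then have "(u @ v') ! i \<in> set u" by (simp add: nth_append)
    then show ?thesis using gt(1)[OF j] absu_le by fastforce
  qed
  ultimately show ?thesis by (simp add: phi_inv_def uv)
qed

text \<open>Reversal of values followed by negation sends \<open>x\<close> to
  \<open>-(m + 1 - x)\<close>. This is a translation, so it keeps the order while making every
  letter negative.\<close>

lemma w0_mult:
  assumes "v \<in> S m"
  shows "w0_B m \<cdot> w0_S m \<cdot> v = map (\<lambda>x. x - int m - 1) v"
proof -
  have "app (w0_B m \<cdot> w0_S m) x = x - int m - 1" if "x \<in> set v" for x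
  proof -
    have x: "1 \<le> x" "x \<le> int m" using assms that by (auto simp: S_iff)
    have "w0_S m ! (nat x - 1) = int m + 1 - x"
      using x by (simp add: w0_S_def rev_nth)
    moreover have "w0_B m ! (nat (int m + 1 - x) - 1) = x - int m - 1"
      using x by (simp add: w0_B_def)
    moreover have "nat x - 1 < length (w0_S m)" using x by (simp add: w0_S_def)
    ultimately show ?thesis using x by (simp add: app_def comp_sp_def)
  qed
  then show ?thesis by (simp add: comp_sp_def)
qed

lemma phi_graph_inv: "phi_graph n w u \<Longrightarrow> phi_inv w u"
proof (induction rule: phi_graph.induct)
  case base
  show ?case by (simp add: phi_inv_def order_iso_def B_def)
next
  case (asc n w p u)
  then have d: "distinct w" by (auto simp: K_S_def S_distinct)
  have "phi_inv (take p w @ drop p w) (u \<oplus> st (drop p w))"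
  proof (rule phi_inv_append[OF asc.IH])
    show "st (drop p w) \<in> B (length (st (drop p w)))"
      using st_in_S[of "drop p w"] d by (simp add: S_def)
    show "sgn x = 1" if "x \<in> set (st (drop p w))" for x
      using that d by (simp add: set_st)
  \<comment> \<open>The ascent rule leaves its prefix as it is, so the required order isomorphism of
    prefixes is reflexivity.\<close>
  qed (use asc.hyps in \<open>auto simp: order_iso_st GAsc_iff order_iso_def[of "take p w"]\<close>)
  then show ?case by simp
next
  case (des n w p u)
  let ?m = "n + 1 - p" and ?d = "drop p w"
  have S: "w \<in> S (n + 1)" using des.hyps by (simp add: K_S_def)
  then have l: "length ?d = ?m" by (simp add: S_iff)
  have "st ?d \<in> S (length ?d)" using S_distinct[OF S] by (intro st_in_S) simp
  then have dS: "?d \<in> S ?m" using st_drop_GDes[OF S des.hyps(3)] l by simp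
  then have set_d: "set ?d = {1..int ?m}" by (simp add: S_iff)
  let ?v = "map (\<lambda>x. x - int ?m - 1) ?d"
  have neg: "- int ?m \<le> x \<and> x < 0" if "x \<in> set ?v" for x
    using that set_d by auto
  have "phi_inv (take p w @ ?d) (u \<oplus> ?v)"
  proof (rule phi_inv_append[OF des.IH])
    have "abs ` set ?v = (\<lambda>x. \<bar>x - int ?m - 1\<bar>) ` {1..int ?m}"
      by (simp only: set_map set_d image_image)
    also have "\<dots> = (\<lambda>x. int ?m + 1 - x) ` {1..int ?m}" by (rule image_cong) auto
    also have "\<dots> = {1..int ?m}" by simp
    finally show "?v \<in> B (length ?v)" using l by (simp add: B_def)
    show "order_iso ?v ?d" by (intro order_iso_map) (simp add: strict_mono_on_def)
    show "sgn x = -1" if "x \<in> set ?v" for x using neg[OF that] by simp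
  qed (use des.hyps in \<open>auto simp: order_iso_st GDes_iff\<close>)
  then show ?case by (simp only: w0_mult[OF dS] append_take_drop_id)
qed

section \<open>Uniqueness of the value of the recursion\<close>

lemma B_nth_eq_rank:
  assumes "u \<in> B n" "j < n"
  shows "\<bar>u ! j\<bar> = int (card {k. k < n \<and> \<bar>u ! k\<bar> \<le> \<bar>u ! j\<bar>})"
proof -
  let ?K = "{k. k < n \<and> \<bar>u ! k\<bar> \<le> \<bar>u ! j\<bar>}"
  have l: "length u = n" and im: "abs ` set u = {1..int n}" using assms(1) by (auto simp: B_def)
  have idx: "(\<lambda>k. \<bar>u ! k\<bar>) ` {..<n} = {1..int n}"
    using im l by (force simp: in_set_conv_nth image_def)
  have j: "\<bar>u ! j\<bar> \<le> int n" using idx assms(2) by fastforce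
  have "inj_on (\<lambda>k. \<bar>u ! k\<bar>) ?K"
    using B_distinct_abs[OF assms(1)] l
    by (auto simp: inj_on_def distinct_conv_nth)
  then have "card ?K = card ((\<lambda>k. \<bar>u ! k\<bar>) ` ?K)" by (simp add: card_image)
  also have "(\<lambda>k. \<bar>u ! k\<bar>) ` ?K = {x \<in> (\<lambda>k. \<bar>u ! k\<bar>) ` {..<n}. x \<le> \<bar>u ! j\<bar>}" by auto
  also have "\<dots> = {1..\<bar>u ! j\<bar>}" unfolding idx using j by auto
  finally show ?thesis by simp
qed

text \<open>Comparison with the first letter of \<open>w\<close> fixes all signs. Absolute values
  compare as the letters do (reversed for negative ones) when signs agree, and by position when they
  differ. As the absolute values fill \<open>{1..n}\<close>, each equals its rank and is thereby
  determined.\<close>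

lemma phi_inv_unique:
  assumes "phi_inv w u" "phi_inv w u'"
  shows "u = u'"
proof -
  define n where "n = length u"
  have l: "length u = n" "length u' = n" "length w = Suc n"
    using assms by (auto simp: phi_inv_def order_iso_def n_def)
  have B: "u \<in> B n" "u' \<in> B n" using assms l by (auto simp: phi_inv_def)
  have ord: "(0 # u) ! i < (0 # u) ! j \<longleftrightarrow> (0 # u') ! i < (0 # u') ! j" if "i \<le> n" "j \<le> n" for i j
    using assms that l by (auto simp: phi_inv_def order_iso_def)
  have ord': "u ! i < u ! j \<longleftrightarrow> u' ! i < u' ! j" if "i < n" "j < n" for i j
    using ord[of "Suc i" "Suc j"] that by simp
  \<comment> \<open>Index 0 is the prefixed letter 0 in both words.\<close>
  have sgn: "sgn (u ! j) = sgn (u' ! j)" if "j < n" for j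
    using ord[of 0 "Suc j"] ord[of "Suc j" 0] that by (auto simp: sgn_if)
  have mixed: "\<bar>u ! i\<bar> < \<bar>u ! j\<bar> \<and> \<bar>u' ! i\<bar> < \<bar>u' ! j\<bar>"
    if "i < j" "j < n" "sgn (u ! i) \<noteq> sgn (u ! j)" for i j
    using assms that l sgn[of i] sgn[of j] by (auto simp: phi_inv_def)
  have abs: "\<bar>u ! k\<bar> \<le> \<bar>u ! j\<bar> \<longleftrightarrow> \<bar>u' ! k\<bar> \<le> \<bar>u' ! j\<bar>" if "j < n" "k < n" for j k
  proof (cases "sgn (u ! k) = sgn (u ! j)")
    case True
    then show ?thesis
      using sgn[OF that(1)] sgn[OF that(2)] ord'[OF that] ord'[OF that(2,1)]
      by (auto simp: sgn_if split: if_splits)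
  next
    case False
    then have "k \<noteq> j" by auto
    then show ?thesis using mixed[of k j] mixed[of j k] False that by (cases "k < j") auto
  qed
  have "u ! j = u' ! j" if "j < n" for j
  proof -
    have "\<bar>u ! j\<bar> = \<bar>u' ! j\<bar>"
      using B_nth_eq_rank[OF B(1) that] B_nth_eq_rank[OF B(2) that] abs[OF that]
      by (simp cong: conj_cong)
    then show ?thesis using sgn[OF that] by (metis sgn_mult_abs)
  qed
  then show ?thesis using l by (simp add: nth_equalityI)
qed

section \<open>Separable permutations are decomposable\<close>

text \<open>Words are functions with an explicit length: negating the values turns global descents
  into global ascents and the pattern 2413 into 3142, and lowering the length drops the last
  letter.\<close>

definition global_ascent :: "(nat \<Rightarrow> int) \<Rightarrow> nat \<Rightarrow> nat \<Rightarrow> bool" where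
  "global_ascent f n p \<longleftrightarrow> 0 < p \<and> p < n \<and> (\<forall>i<p. \<forall>j. p \<le> j \<longrightarrow> j < n \<longrightarrow> f i < f j)"

definition avoids_3142 :: "(nat \<Rightarrow> int) \<Rightarrow> nat \<Rightarrow> bool" where
  "avoids_3142 f n \<longleftrightarrow>
     \<not> (\<exists>i j k l. i < j \<and> j < k \<and> k < l \<and> l < n \<and> f j < f l \<and> f l < f i \<and> f i < f k)"

text \<open>
  Take the first global ascent \<open>p\<close> of the word without its last letter \<open>x\<close>. If \<open>x\<close> lies strictly
  between letters of the first block, then letters \<open>a > x > b\<close> of this block in this order would
  give the pattern 3142 as \<open>a, b, f p, x\<close>; so the letters below \<open>x\<close> precede those above \<open>x\<close>, which
  is an earlier global ascent.
\<close>

lemma global_ascent_Suc: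
  assumes inj: "inj_on f {..n}" and av: "avoids_3142 f (Suc n)" and ex: "\<exists>p. global_ascent f n p"
  shows "\<exists>p. global_ascent f (Suc n) p \<or> global_ascent (\<lambda>i. - f i) (Suc n) p"
proof -
  define p where "p = (LEAST p. global_ascent f n p)"
  have p: "global_ascent f n p" unfolding p_def using ex by (rule LeastI_ex)
  then have p0: "0 < p" "p < n" by (auto simp: global_ascent_def)
  have lt: "f i < f j" if "i < p" "p \<le> j" "j < n" for i j
    using p that by (auto simp: global_ascent_def)
  have least: "\<not> global_ascent f n q" if "q < p" for q
    using that not_less_Least unfolding p_def by blast
  have ne: "f i \<noteq> f n" if "i < n" for i
    using inj that by (auto simp: inj_on_def)
  consider "\<forall>i<p. f i < f n" | "\<forall>i<p. f n < f i"
    | a b where "a < p" "f n < f a" "b < p" "f b < f n"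
    using ne p0 by (meson linorder_neqE less_trans)
  then show ?thesis
  proof cases
    case 1
    then have "global_ascent f (Suc n) p"
      using p0 lt by (auto simp: global_ascent_def less_Suc_eq)
    then show ?thesis by blast
  next
    case 2
    \<comment> \<open>Letters from position \<open>p\<close> on exceed the first block, so the last
      letter is the minimum and splitting it off gives a global descent.\<close>
    have "f n < f i" if "i < n" for i
      using 2 lt[of 0 i] p0 that by (cases "i < p") force+
    then have "global_ascent (\<lambda>i. - f i) (Suc n) n"
      using p0 by (auto simp: global_ascent_def less_Suc_eq)
    then show ?thesis by blast
  next
    case (3 a b)
    have no: "f j > f n" if "i < j" "j < p" "f n < f i" for i j
    proof (rule ccontr)
      assume "\<not> f n < f j"
      then have "f j < f n" using ne[of j] that p0 by force
      moreover have "f i < f p" using lt that p0 by simp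
      ultimately show False using av that p0 unfolding avoids_3142_def by blast
    qed
    define q where "q = (LEAST i. f n < f i)"
    have q: "f n < f q" "q \<le> a" unfolding q_def using 3 by (auto intro: LeastI Least_le)
    have qmin: "f i < f n" if "i < q" for i
      using not_less_Least[of i "\<lambda>i. f n < f i"] that ne[of i] q 3 p0 unfolding q_def by force
    \<comment> \<open>Otherwise the block starts above the last letter, and \<open>no\<close> forces
      all of the block, including position \<open>b\<close>, above it.\<close>
    have "q \<noteq> 0"
    proof
      assume "q = 0"
      then have "f n < f 0" using q(1) by simp
      then show False using no[of 0 b] 3(3,4) by (cases "b = 0") auto
    qed
    moreover have "f i < f j" if "i < q" "q \<le> j" "j < n" for i j
    proof (cases "j < p")
      case True
      then have "f n < f j" using no[of q j] q that by (cases "j = q") auto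
      then show ?thesis using qmin[OF that(1)] by simp
    qed (use lt that q 3 in auto)
    ultimately have "global_ascent f n q" using q 3 p0 by (auto simp: global_ascent_def)
    then show ?thesis using least q 3 by auto
  qed
qed

text \<open>Induction on the length, restoring the last letter. The hypotheses are symmetric under
  negation, so the case of a global descent is \<open>global_ascent_Suc\<close> applied to the
  negated word.\<close>

lemma global_ascent_exists:
  assumes "2 \<le> n" "inj_on f {..<n}" "avoids_3142 f n" "avoids_3142 (\<lambda>i. - f i) n"
  shows "\<exists>p. global_ascent f n p \<or> global_ascent (\<lambda>i. - f i) n p"
  using assms
proof (induction n rule: dec_induct)
  case base
  then have "f 0 \<noteq> f 1" using inj_onD[of f "{..<2}" 0 1] by auto
  then have "global_ascent f 2 1 \<or> global_ascent (\<lambda>i. - f i) 2 1"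
    by (auto simp: global_ascent_def less_2_cases_iff)
  then show ?case by blast
next
  case (step n)
  have inj: "inj_on f {..n}" "inj_on (\<lambda>i. - f i) {..n}"
    using step.prems(1) by (auto simp: lessThan_Suc_atMost inj_on_def)
  have "avoids_3142 g n" if "avoids_3142 g (Suc n)" for g
    using that unfolding avoids_3142_def by (meson less_SucI)
  moreover have "inj_on f {..<n}" using inj(1) by (rule inj_on_subset) auto
  ultimately consider "\<exists>p. global_ascent f n p" | "\<exists>p. global_ascent (\<lambda>i. - f i) n p"
    using step by blast
  then show ?case
  proof cases
    case 1
    then show ?thesis using global_ascent_Suc[OF inj(1) step.prems(2)] by blast
  next
    case 2
    then show ?thesis using global_ascent_Suc[OF inj(2) step.prems(3)] by auto
  qed
qed

section \<open>Patterns\<close>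

lemma subseq_map_nth:
  assumes "sorted_wrt (<) is" "set is \<subseteq> {..<length w}"
  shows "subseq (map ((!) w) is) w"
proof -
  \<comment> \<open>A strictly increasing index list is recovered from its set, hence is a filter of
    the list of all indices.\<close>
  have "is = filter (\<lambda>i. i \<in> set is) [0..<length w]"
    using assms by (intro sorted_distinct_set_unique)
      (auto simp: strict_sorted_iff intro: sorted_wrt_filter)
  then have "subseq is [0..<length w]" by (metis subseq_filter_left)
  then have "subseq (map ((!) w) is) (map ((!) w) [0..<length w])" by (rule subseq_map)
  then show ?thesis by (simp add: map_nth)
qed

lemma sts_3142:
  assumes "0 < b" "b < d" "d < a" "a < (c::int)"
  shows "sts [a, b, c, d] = [3, 1, 4, 2]"
proof -
  have "{y \<in> set [a, b, c, d]. \<bar>y\<bar> \<le> \<bar>a\<bar>} = {a, b, d}" "{y \<in> set [a, b, c, d]. \<bar>y\<bar> \<le> \<bar>b\<bar>} = {b}"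
    "{y \<in> set [a, b, c, d]. \<bar>y\<bar> \<le> \<bar>c\<bar>} = {a, b, c, d}" "{y \<in> set [a, b, c, d]. \<bar>y\<bar> \<le> \<bar>d\<bar>} = {b, d}"
    using assms by auto
  then show ?thesis using assms unfolding sts_def by (simp only: list.map) auto
qed

lemma sts_2413:
  assumes "0 < c" "c < a" "a < d" "d < (b::int)"
  shows "sts [a, b, c, d] = [2, 4, 1, 3]"
proof -
  have "{y \<in> set [a, b, c, d]. \<bar>y\<bar> \<le> \<bar>a\<bar>} = {a, c}" "{y \<in> set [a, b, c, d]. \<bar>y\<bar> \<le> \<bar>c\<bar>} = {c}"
    "{y \<in> set [a, b, c, d]. \<bar>y\<bar> \<le> \<bar>b\<bar>} = {a, b, c, d}" "{y \<in> set [a, b, c, d]. \<bar>y\<bar> \<le> \<bar>d\<bar>} = {a, c, d}"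
    using assms by auto
  then show ?thesis using assms unfolding sts_def by (simp only: list.map) auto
qed

text \<open>On positive letters absolute values are the letters themselves, so \<open>sts\<close>
  sees only the relative order.\<close>

lemma sts_map:
  assumes "strict_mono_on (set a) f" "\<And>x. x \<in> set a \<Longrightarrow> 0 < x" "\<And>x. x \<in> set a \<Longrightarrow> 0 < f x"
  shows "sts (map f a) = sts a"
proof -
  have "sgn (f x) * int (card {y \<in> set (map f a). \<bar>y\<bar> \<le> \<bar>f x\<bar>}) =
        sgn x * int (card {y \<in> set a. \<bar>y\<bar> \<le> \<bar>x\<bar>})" if x: "x \<in> set a" for x
  proof -
    have "\<bar>f y\<bar> \<le> \<bar>f x\<bar> \<longleftrightarrow> \<bar>y\<bar> \<le> \<bar>x\<bar>" if "y \<in> set a" for y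
      using strict_mono_on_less_eq[OF assms(1) that x] assms(2,3)[OF x] assms(2,3)[OF that] by simp
    then have "{y \<in> set (map f a). \<bar>y\<bar> \<le> \<bar>f x\<bar>} = f ` {y \<in> set a. \<bar>y\<bar> \<le> \<bar>x\<bar>}" by auto
    moreover have "inj_on f {y \<in> set a. \<bar>y\<bar> \<le> \<bar>x\<bar>}"
      using strict_mono_on_imp_inj_on[OF assms(1)] by (rule inj_on_subset) auto
    ultimately show ?thesis using assms(2,3)[OF x] by (simp add: card_image)
  qed
  then show ?thesis by (simp add: sts_def)
qed

lemma contains_subseq: "contains a u \<Longrightarrow> subseq a b \<Longrightarrow> contains b u"
  unfolding contains_def using subseq_order.order_trans by blast

text \<open>A subsequence of \<open>st a\<close> is the image under the rank map of the subsequence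
  of \<open>a\<close> at the same positions; ranks are positive and increasing, so both have the
  same pattern.\<close>

lemma contains_st:
  assumes "distinct a" "\<And>x. x \<in> set a \<Longrightarrow> 0 < x" "contains (st a) u"
  shows "contains a u"
proof -
  let ?r = "\<lambda>x. int (card {y \<in> set a. y \<le> x})"
  obtain v where v: "subseq v (map ?r a)" "sts v = u"
    using assms(3) by (auto simp: contains_def st_def)
  then obtain N where "v = nths (map ?r a) N" by (auto simp: subseq_conv_nths)
  then have v': "v = map ?r (nths a N)" by (simp add: nths_map)
  have sub: "set (nths a N) \<subseteq> set a" by (rule set_nths_subset)
  have "sts (map ?r (nths a N)) = sts (nths a N)"
  proof (rule sts_map)
    show "strict_mono_on (set (nths a N)) ?r"
      using strict_mono_on_rank[of "set a"] sub by (auto simp: strict_mono_on_def)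
    fix x assume "x \<in> set (nths a N)"
    then have x: "x \<in> set a" using sub by blast
    then show "0 < x" by (rule assms(2))
    have "?r x \<in> set (st a)" using x by (simp add: st_def)
    then show "0 < ?r x" unfolding set_st[OF assms(1)] by simp
  qed
  then show ?thesis using v v' unfolding contains_def by (metis subseq_conv_nths)
qed

lemma K_S_st_take:
  assumes "w \<in> K_S n" "p \<le> n"
  shows "st (take p w) \<in> K_S p"
proof -
  have w: "w \<in> S n" "w \<in> K_B n" using assms by (auto simp: K_S_def)
  have l: "length (take p w) = p" using w assms(2) by (simp add: S_iff)
  have d: "distinct (take p w)" using S_distinct[OF w(1)] by simp
  have pos: "0 < x" if "x \<in> set (take p w)" for x
    using w(1) in_set_takeD[OF that] by (simp add: S_def)
  have "st (take p w) \<in> S p" using st_in_S[OF d] l by simp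
  moreover have "contains w u" if "contains (st (take p w)) u" for u
  proof (rule contains_subseq[OF contains_st[OF d pos that]])
    show "subseq (take p w) w" by (metis append_take_drop_id subseq_order.order_refl subseq_rev_drop_many)
  qed
  ultimately show ?thesis using w by (auto simp: K_S_def K_B_def S_def)
qed

text \<open>The second claim is avoidance of 2413, read through negation of the values.\<close>

lemma K_S_avoids_3142:
  assumes "w \<in> K_S n"
  shows "avoids_3142 ((!) w) n" "avoids_3142 (\<lambda>i. - w ! i) n"
proof -
  have l: "length w = n" and pos: "\<And>i. i < n \<Longrightarrow> 0 < w ! i"
    and c: "\<not> contains w [3, 1, 4, 2]" "\<not> contains w [2, 4, 1, 3]"
    using assms by (auto simp: K_S_def S_def B_def K_B_def)
  have sub: "subseq [w ! i, w ! j, w ! k, w ! m] w" if "i < j" "j < k" "k < m" "m < n" for i j k m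
    using subseq_map_nth[of "[i, j, k, m]" w] that l by simp
  show "avoids_3142 ((!) w) n"
    unfolding avoids_3142_def
  proof safe
    fix i j k m assume *: "i < j" "j < k" "k < m" "m < n" "w ! j < w ! m" "w ! m < w ! i" "w ! i < w ! k"
    then have "sts [w ! i, w ! j, w ! k, w ! m] = [3, 1, 4, 2]" using pos[of j] by (intro sts_3142) auto
    then show False using c(1) sub[OF *(1-4)] unfolding contains_def by blast
  qed
  show "avoids_3142 (\<lambda>i. - w ! i) n"
    unfolding avoids_3142_def
  proof safe
    fix i j k m assume *: "i < j" "j < k" "k < m" "m < n"
      "- w ! j < - w ! m" "- w ! m < - w ! i" "- w ! i < - w ! k"
    then have "sts [w ! i, w ! j, w ! k, w ! m] = [2, 4, 1, 3]" using pos[of k] by (intro sts_2413) auto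
    then show False using c(2) sub[OF *(1-4)] unfolding contains_def by blast
  qed
qed

lemma global_ascent_imp_GAsc: "global_ascent ((!) w) (length w) p \<Longrightarrow> p \<in> GAsc w"
  by (auto simp: GAsc_def global_ascent_def)

lemma global_ascent_imp_GDes: "global_ascent (\<lambda>i. - w ! i) (length w) p \<Longrightarrow> p \<in> GDes w"
  by (auto simp: GDes_def global_ascent_def)

lemma K_S_GAsc_or_GDes:
  assumes "w \<in> K_S n" "2 \<le> n"
  shows "\<exists>p. p \<in> GAsc w \<or> p \<in> GDes w"
proof -
  have l: "length w = n" and "distinct w"
    using assms S_distinct[of w n] by (auto simp: K_S_def S_iff)
  then have "inj_on ((!) w) {..<n}" by (auto simp: inj_on_def distinct_conv_nth)
  then obtain p where "global_ascent ((!) w) n p \<or> global_ascent (\<lambda>i. - w ! i) n p"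
    using global_ascent_exists[OF assms(2) _ K_S_avoids_3142[OF assms(1)]] by blast
  then show ?thesis using global_ascent_imp_GAsc global_ascent_imp_GDes l by blast
qed

section \<open>Existence of a value, and the invariant for \<open>phi\<close>\<close>

lemma phi_graph_exists: "w \<in> K_S (n + 1) \<Longrightarrow> \<exists>u. phi_graph n w u"
proof (induction n arbitrary: w rule: less_induct)
  case (less n)
  have S: "w \<in> S (n + 1)" using less.prems by (simp add: K_S_def)
  show ?case
  proof (cases "n = 0")
    case True
    then have l: "length w = Suc 0" "set w = {1}" using S by (simp_all add: S_iff)
    then obtain x where "w = [x]" by (auto simp: length_Suc_conv)
    then have "w = [1]" using l(2) by simp
    then show ?thesis using True phi_graph.base by auto
  next
    case False
    then obtain p where p: "p \<in> GAsc w \<or> p \<in> GDes w"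
      using K_S_GAsc_or_GDes[OF less.prems] by auto
    then have "0 < p" "p < length w" by (auto simp: GAsc_iff GDes_iff)
    then have p': "0 < p" "p \<le> n" using S by (auto simp: S_iff)
    have "st (take p w) \<in> K_S p" using K_S_st_take[OF less.prems, of p] p' by simp
    \<comment> \<open>The prefix has length \<open>p = (p - 1) + 1\<close>, so the induction
      hypothesis is used at index \<open>p - 1 < n\<close>.\<close>
    then obtain u where u: "phi_graph (p - 1) (st (take p w)) u"
      using less.IH[of "p - 1"] p' by force
    show ?thesis
    proof (cases "p \<in> GAsc w")
      case True
      then show ?thesis
        using phi_graph.asc[of n w p u] u st_take_GAsc[OF S True] less.prems p' by auto
    next
      case False
      then show ?thesis
        using phi_graph.des[of n w p u] u p less.prems p' by auto
    qed
  qed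
qed

lemma phi_inv_phi:
  assumes "w \<in> K_S (n + 1)"
  shows "phi_inv w (phi n w)"
proof -
  obtain u where u: "phi_graph n w u" using phi_graph_exists[OF assms] by blast
  then have "phi n w = u"
    unfolding phi_def using phi_inv_unique phi_graph_inv by (intro the_equality) blast+
  then show ?thesis using phi_graph_inv[OF u] by simp
qed

section \<open>Descents\<close>

text \<open>The convention \<open>w\<^sub>0 = 0\<close> becomes an actual first letter, and the
  infinite letter at position -1 becomes the infinite letter at position 0 of type A.\<close>

lemma letter_B_eq_letter_A: "letter_B u i = letter_A (0 # u) (i + 1)"
  by (auto simp: letter_B_def letter_A_def nth_Cons' nat_add_distrib)

text \<open>Positions outside the word carry infinity in both words, as their lengths agree; only
  comparisons inside need the order isomorphism.\<close>

lemma letter_A_less_cong: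
  assumes "order_iso a b"
  shows "letter_A a i < letter_A a j \<longleftrightarrow> letter_A b i < letter_A b j"
proof -
  have "a ! (nat i - 1) < a ! (nat j - 1) \<longleftrightarrow> b ! (nat i - 1) < b ! (nat j - 1)"
    if "1 \<le> i" "i \<le> int (length a)" "1 \<le> j" "j \<le> int (length a)"
  proof -
    have "nat i - 1 < length a" "nat j - 1 < length a" using that by linarith+
    then show ?thesis using assms by (simp add: order_iso_def)
  qed
  moreover have "length b = length a" using assms by (simp add: order_iso_def)
  ultimately show ?thesis by (auto simp: letter_A_def)
qed

lemma Des_A_cong:
  assumes "order_iso a b"
  shows "Des_A a = Des_A b"
proof -
  have "length a = length b" using assms by (simp add: order_iso_def)
  then show ?thesis unfolding Des_A_def by (simp add: letter_A_less_cong[OF assms])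
qed

lemma DDes_A_cong:
  assumes "order_iso a b"
  shows "DDes_A a = DDes_A b"
proof -
  have "length a = length b" using assms by (simp add: order_iso_def)
  then show ?thesis unfolding DDes_A_def by (simp add: letter_A_less_cong[OF assms])
qed

lemma Collect_add_1: "{i + 1 | i. i \<in> X} = {j. j - 1 \<in> X}" for X :: "int set"
proof -
  have "\<exists>i. j = i + 1 \<and> i \<in> X" if "j - 1 \<in> X" for j
    using that by (intro exI[of _ "j - 1"]) simp
  then show ?thesis by auto
qed

lemma Des_A_Cons_0: "Des_A (0 # u) = {i + 1 | i. i \<in> Des_B u}"
proof -
  have "j \<in> Des_A (0 # u) \<longleftrightarrow> j - 1 \<in> Des_B u" for j
    by (auto simp: Des_A_def Des_B_def letter_B_eq_letter_A add.commute)
  then show ?thesis by (auto simp: Collect_add_1)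
qed

lemma DDes_A_Cons_0: "DDes_A (0 # u) = {i + 1 | i. i \<in> DDes_B u}"
proof -
  have "j \<in> DDes_A (0 # u) \<longleftrightarrow> j - 1 \<in> DDes_B u" for j
    by (auto simp: DDes_A_def DDes_B_def letter_B_eq_letter_A add.commute)
  then show ?thesis by (auto simp: Collect_add_1)
qed

theorem lemma4p7:
  fixes n :: nat and w :: "int list"
  assumes "w \<in> K_S (n + 1)"
  shows "Des_A w = {i + 1 | i. i \<in> Des_B (phi n w)} \<and>
         DDes_A w = {i + 1 | i. i \<in> DDes_B (phi n w)}"
proof -
  have "order_iso (0 # phi n w) w" using phi_inv_phi[OF assms] by (simp add: phi_inv_def)
  then show ?thesis
    using Des_A_cong DDes_A_cong Des_A_Cons_0 DDes_A_Cons_0 by metis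
qed

end
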